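(* Let $\mathcal{L}_n=\{L_1,L_2,\ldots,L_n\}$ ($n\ge 3$) be an infinity type line arrangement (with the conventions in the context) with infinity permutation $\sigma$ and nomenclature $\sigma(1)^{a_1}\sigma(2)^{a_2}\ldots\sigma(n)^{a_n}$. Let $1\leq t<n$ with $a_t=+1$. Here the integer $\sigma(m)$ is called a symbol, with superscript $a_m$; symbols are compared as integers; "before/after" and "to the right" refer to positions in the nomenclature. Then $L_{\sigma(t)}$ is a line at infinity with respect to the arrangement $\mathcal{L}_n$ if and only if the conditions listed in whichever of the following three cases applies hold. (1) There exists $u$ with $t<u\leq n$, $a_u=+1$, such that there is no $w$ with $u<w\leq n$ and $a_w=+1$, and $\sigma(t)<\sigma(u)$. Conditions: (A) All the symbols after $\sigma(t)$ with $+1$ superscript are more than $\sigma(t)$ and they increase as we move to the right. (B) All the symbols which occur after $\sigma(t)$ with $-1$ superscript are less than all the symbols which occur after $\sigma(t)$ with $+1$ superscript. (C) All the symbols which occur before $\sigma(t)$ are more than $\sigma(t)$ and lie in between those symbols which occur after $\sigma(t)$ with $-1$ superscript and those symbols which occur after $\sigma(t)$ with $+1$ superscript (i.e. they are greater than all the former and less than all the latter). (D) All the symbols after $\sigma(t)$ and before $\sigma(u)$ with $-1$ superscript are more than $\sigma(t)$ and decrease as we move to the right. (E) All the symbols after $\sigma(u)$ have $-1$ superscript and they can be more than or less than $\sigma(t)$. Among them, those which are less than $\sigma(t)$ increase as we move to the right. Among them, those which are more than $\sigma(t)$ decrease as we move to the right and are smaller than those symbols with $-1$ superscript which are in between (in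 position) $\sigma(t)$ and $\sigma(u)$. (2) There does not exist $u$ with $t<u\leq n$ and $a_u=+1$. Conditions: (i) All the symbols after $\sigma(t)$ have $-1$ superscript and they can be more than or less than $\sigma(t)$. Among them, those which are less than $\sigma(t)$ increase as we move to the right, and those which are more than $\sigma(t)$ decrease as we move to the right. (ii) All the symbols which occur before $\sigma(t)$ and which are more than $\sigma(t)$ are greater than all the symbols which occur after $\sigma(t)$. (iii) All the symbols which occur before $\sigma(t)$ and which are less than $\sigma(t)$ are less than all the symbols which occur after $\sigma(t)$. (3) There exists $u$ with $t<u\leq n$, $a_u=+1$, such that there is no $w$ with $u<w\leq n$ and $a_w=+1$, and $\sigma(u)<\sigma(t)$. Conditions: (a) All the symbols after $\sigma(t)$ with $+1$ superscript are less than $\sigma(t)$ and they decrease as we move to the right. (b) All the symbols which occur after $\sigma(t)$ with $-1$ superscript are more than all the symbols which occur after $\sigma(t)$ with $+1$ superscript. (c) All the symbols which occur before $\sigma(t)$ are less than $\sigma(t)$ and lie in between those symbols which occur after $\sigma(t)$ with $+1$ superscript and those symbols which occur after $\sigma(t)$ with $-1$ superscript (i.e. they are greater than all the former and less than all the latter). (d) All the symbols after $\sigma(t)$ and before $\sigma(u)$ with $-1$ superscript are less than $\sigma(t)$ and increase as we move to the right. (e) All the symbols after $\sigma(u)$ have $-1$ superscript and they can be more than or less than $\sigma(t)$. Among them, those which are more than $\sigma(t)$ decrease as we move to the right. Among them, those which are less than $\sigma(t)$ increase as we move to the right and are bigger than those symbols with $-1$ superscript which are in between (in position) $\sigma(t)$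 and $\sigma(u)$.
   Context: Line arrangement: a finite set $\mathcal{L}_n=\{L_1,\ldots,L_n\}$ of lines in $\mathbb{R}^2$, no two parallel and no three concurrent. Convention: the angle $\theta_i$ of $L_i$ with respect to the positive $X$-axis satisfies $0<\theta_1<\theta_2<\cdots<\theta_n<\pi$; moreover (after a translation of the arrangement) all intersection points of pairs of lines lie in the first quadrant and every line meets the positive $X$-axis. The symbol $\pi$ denotes the number; $\sigma$ denotes a permutation. Line at infinity: a line $L$ is a line at infinity with respect to a line arrangement $\mathcal{L}$ if $\mathcal{L}\cup\{L\}$ is a line arrangement and all vertices (pairwise intersection points of lines of $\mathcal{L}$) lie on one side of $L$ (the side being allowed to include the line $L$ itself if $L\in\mathcal{L}$). Infinity type: $\mathcal{L}_n$ is an infinity type line arrangement if there is a permutation $\sigma\in S_n$ such that for each $2\leq l\leq n$ the line $L_{\sigma(l)}$ is a line at infinity with respect to $\{L_{\sigma(1)},\ldots,L_{\sigma(l-1)}\}$. Such a $\sigma$ is called an infinity permutation of $\mathcal{L}_n$ (not necessarily unique). Nomenclature: given an infinity permutation $\sigma$, the nomenclature is the string $\sigma(1)^{a_1}\sigma(2)^{a_2}\ldots\sigma(n)^{a_n}$ with superscripts $a_l\in\{+1,-1\}$ defined as follows. For $l\in\{1,2,3\}$: $a_l=+1$ if $L_{\sigma(l)}$ does not separate the origin from the intersection point of the other two lines among $L_{\sigma(1)},L_{\sigma(2)},L_{\sigma(3)}$, and $a_l=-1$ if it does. For $l\geq 4$: $a_l=+1$ if $L_{\sigma(l)}$ does not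 separate the origin from the vertices of the arrangement $\{L_{\sigma(1)},\ldots,L_{\sigma(l-1)}\}$ (which all lie on one side of $L_{\sigma(l)}$), and $a_l=-1$ if it does. *)

theory Defs
  imports "HOL-Analysis.Analysis" "HOL-Combinatorics.Permutations"
begin

definition is_line :: "(real^2) set \<Rightarrow> bool" where
  "is_line l \<longleftrightarrow> affine l \<and> aff_dim l = 1"

text \<open>Two distinct lines of the plane are parallel iff they are disjoint.\<close>

definition line_arrangement :: "(real^2) set set \<Rightarrow> bool" where
  "line_arrangement A \<longleftrightarrow>
     finite A \<and>
     (\<forall>l\<in>A. is_line l) \<and>
     (\<forall>l\<in>A. \<forall>m\<in>A. l \<noteq> m \<longrightarrow> l \<inter> m \<noteq> {}) \<and>
     (\<forall>l\<in>A. \<forall>m\<in>A. \<forall>k\<in>A. l \<noteq> m \<and> l \<noteq> k \<and> m \<noteq> k \<longrightarrow> l \<inter> m \<inter> k = {})"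

definition vertices :: "(real^2) set set \<Rightarrow> (real^2) set" where
  "vertices A = {p. \<exists>l\<in>A. \<exists>m\<in>A. l \<noteq> m \<and> p \<in> l \<and> p \<in> m}"

text \<open>Every line has exactly two open sides, obtained from \<open>(c, d)\<close> and \<open>(- c, - d)\<close>.\<close>

definition open_side :: "(real^2) set \<Rightarrow> (real^2) set \<Rightarrow> bool" where
  "open_side l H \<longleftrightarrow>
     (\<exists>c d. c \<noteq> 0 \<and> l = {x. c \<bullet> x = d} \<and> H = {x. c \<bullet> x < d})"

definition separates :: "(real^2) set \<Rightarrow> real^2 \<Rightarrow> real^2 \<Rightarrow> bool" where
  "separates l p q \<longleftrightarrow>
     (\<exists>H K. open_side l H \<and> open_side l K \<and> H \<inter> K = {} \<and> p \<in> H \<and> q \<in> K)"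

definition line_at_infinity :: "(real^2) set \<Rightarrow> (real^2) set set \<Rightarrow> bool" where
  "line_at_infinity l A \<longleftrightarrow>
     line_arrangement (insert l A) \<and>
     (\<exists>H. open_side l H \<and> vertices A \<subseteq> (if l \<in> A then H \<union> l else H))"

definition has_angle :: "(real^2) set \<Rightarrow> real \<Rightarrow> bool" where
  "has_angle l \<theta> \<longleftrightarrow>
     0 \<le> \<theta> \<and> \<theta> < pi \<and>
     (\<exists>p. l = {p + s *\<^sub>R vector [cos \<theta>, sin \<theta>] | s. True})"

text \<open>
  The standing convention on an arrangement \<open>L 1, \<dots>, L n\<close>. The strict increase of the
  angles makes the lines distinct. The first quadrant is taken to be open.
\<close>

definition standard_position :: "nat \<Rightarrow> (nat \<Rightarrow> (real^2) set) \<Rightarrow> bool" where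
  "standard_position n L \<longleftrightarrow>
     line_arrangement (L ` {1..n}) \<and>
     (\<exists>\<theta>. (\<forall>i\<in>{1..n}. has_angle (L i) (\<theta> i) \<and> 0 < \<theta> i) \<and> strict_mono_on {1..n} \<theta>) \<and>
     (\<forall>v\<in>vertices (L ` {1..n}). 0 < v $ 1 \<and> 0 < v $ 2) \<and>
     (\<forall>i\<in>{1..n}. \<exists>x>0. vector [x, 0] \<in> L i)"

definition infinity_permutation ::
  "nat \<Rightarrow> (nat \<Rightarrow> (real^2) set) \<Rightarrow> (nat \<Rightarrow> nat) \<Rightarrow> bool" where
  "infinity_permutation n L \<sigma> \<longleftrightarrow>
     \<sigma> permutes {1..n} \<and>
     (\<forall>l\<in>{2..n}. line_at_infinity (L (\<sigma> l)) (L ` \<sigma> ` {1..<l}))"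

definition infinity_type :: "nat \<Rightarrow> (nat \<Rightarrow> (real^2) set) \<Rightarrow> bool" where
  "infinity_type n L \<longleftrightarrow> (\<exists>\<sigma>. infinity_permutation n L \<sigma>)"

text \<open>
  The lines whose vertices are compared with the origin at position \<open>l\<close>: the other two of
  the first three lines if \<open>l \<le> 3\<close>, all the preceding lines otherwise.
\<close>

definition reference_lines ::
  "(nat \<Rightarrow> (real^2) set) \<Rightarrow> (nat \<Rightarrow> nat) \<Rightarrow> nat \<Rightarrow> (real^2) set set" where
  "reference_lines L \<sigma> l = L ` \<sigma> ` (if l \<le> 3 then {1,2,3} - {l} else {1..<l})"

text \<open>
  For an infinity permutation the reference vertices all lie strictly on one side of the
  line \<open>L (\<sigma> l)\<close>, so that either all of them or none of them are separated from the origin.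
\<close>

definition superscript :: "(nat \<Rightarrow> (real^2) set) \<Rightarrow> (nat \<Rightarrow> nat) \<Rightarrow> nat \<Rightarrow> int" where
  "superscript L \<sigma> l =
     (if \<forall>v\<in>vertices (reference_lines L \<sigma> l). separates (L (\<sigma> l)) 0 v then -1 else 1)"

definition nomenclature ::
  "nat \<Rightarrow> (nat \<Rightarrow> (real^2) set) \<Rightarrow> (nat \<Rightarrow> nat) \<Rightarrow> (nat \<Rightarrow> int) \<Rightarrow> bool" where
  "nomenclature n L \<sigma> a \<longleftrightarrow> (\<forall>l\<in>{1..n}. a l = superscript L \<sigma> l)"

text \<open>The positions in \<open>I\<close> (not the symbols there) whose superscript is \<open>+1\<close>, resp. \<open>-1\<close>.\<close>

definition pos :: "(nat \<Rightarrow> int) \<Rightarrow> nat set \<Rightarrow> nat set" where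
  "pos a I = {m\<in>I. a m = 1}"

definition neg :: "(nat \<Rightarrow> int) \<Rightarrow> nat set \<Rightarrow> nat set" where
  "neg a I = {m\<in>I. a m = -1}"

end

theory Submission
  imports Defs
begin

text \<open>
  By the standing convention, \<open>L i\<close> is the zero set of
  \<open>h\<^sub>i(x, y) = x - M\<^sub>i y - X\<^sub>i\<close> with \<open>M\<^sub>i = cot \<theta>\<^sub>i\<close> strictly decreasing in \<open>i\<close> and
  \<open>X\<^sub>i > 0\<close>, so that the origin always lies on the negative side. If \<open>v\<^sub>j\<^sub>k\<close> is the common
  point of \<open>L j\<close> and \<open>L k\<close>, then \<open>h\<^sub>i(v\<^sub>j\<^sub>k) (M\<^sub>j - M\<^sub>k)\<close> is an alternating determinant in
  \<open>i, j, k\<close>. Hence the sign of \<open>h\<^sub>t(v\<^sub>p\<^sub>q)\<close> is that of \<open>h\<^sub>q(v\<^sub>t\<^sub>p)\<close> if \<open>p\<close> lies between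
  \<open>t\<close> and \<open>q\<close>, and opposite to it otherwise. For positions \<open>p, t < q\<close> the latter sign is given
  by the superscript at \<open>q\<close>, so \<open>L (\<sigma> t)\<close> is a line at infinity iff, for all positions
  \<open>q > t\<close> and \<open>p < q\<close> with \<open>p \<noteq> t\<close>, the superscript at \<open>q\<close> is \<open>+1\<close> exactly when \<open>\<sigma> p\<close> lies
  between \<open>\<sigma> t\<close> and \<open>\<sigma> q\<close>. The three lists of conditions unfold this criterion.
\<close>

section \<open>Sides of a line\<close>

text \<open>The component of \<open>c'\<close> orthogonal to \<open>c\<close> is a direction inside
  the hyperplane, hence orthogonal to \<open>c'\<close> as well, hence to itself, so it
  vanishes.\<close>

lemma hyperplane_eq_imp_scaled:
  fixes c c' :: "'a::real_inner"
  assumes "c \<noteq> 0" "c' \<noteq> 0" and eq: "{x. c \<bullet> x = d} = {x. c' \<bullet> x = d'}"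
  obtains k where "k \<noteq> 0" "c' = k *\<^sub>R c" "d' = k * d"
proof -
  \<comment> \<open>The foot of the perpendicular from the origin; evaluating \<open>c'\<close>
    there yields \<open>d'\<close>.\<close>
  define p where "p = (d / (c \<bullet> c)) *\<^sub>R c"
  have cp: "c \<bullet> p = d" using \<open>c \<noteq> 0\<close> by (simp add: p_def)
  then have c'p: "c' \<bullet> p = d'" using eq by blast
  define k where "k = (c' \<bullet> c) / (c \<bullet> c)"
  define v where "v = c' - k *\<^sub>R c"
  have cv: "c \<bullet> v = 0"
    using \<open>c \<noteq> 0\<close> by (simp add: v_def k_def inner_diff_right inner_commute)
  then have "c \<bullet> (p + v) = d" by (simp add: inner_add_right cp)
  then have "c' \<bullet> (p + v) = d'" using eq by blast
  then have "c' \<bullet> v = 0" by (simp add: inner_add_right c'p)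
  then have "v \<bullet> v = 0" using cv by (simp add: v_def inner_diff_left)
  then have c': "c' = k *\<^sub>R c" by (simp add: v_def)
  show thesis
  proof (rule that[OF _ c'])
    show "k \<noteq> 0" using c' \<open>c' \<noteq> 0\<close> by auto
    show "d' = k * d" using c'p c' cp by simp
  qed
qed

text \<open>\<open>open_side\<close> ranges over all equations of the line. Two of them differ by a
  nonzero factor, and only its sign affects the side.\<close>

lemma open_side_hyperplane_iff:
  assumes "c \<noteq> 0"
  shows "open_side {x. c \<bullet> x = d} H \<longleftrightarrow> H = {x. c \<bullet> x < d} \<or> H = {x. d < c \<bullet> x}"
proof
  assume "open_side {x. c \<bullet> x = d} H"
  then obtain c' d' where c': "c' \<noteq> 0" "{x. c \<bullet> x = d} = {x. c' \<bullet> x = d'}"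
    and H: "H = {x. c' \<bullet> x < d'}"
    unfolding open_side_def by blast
  obtain k where k: "k \<noteq> 0" "c' = k *\<^sub>R c" "d' = k * d"
    using hyperplane_eq_imp_scaled[OF assms c'] by blast
  show "H = {x. c \<bullet> x < d} \<or> H = {x. d < c \<bullet> x}"
    using k H by (cases "k > 0") (auto simp: mult_less_cancel_left)
next
  have "open_side {x. c \<bullet> x = d} {x. c \<bullet> x < d}"
    unfolding open_side_def using assms by blast
  moreover have "open_side {x. c \<bullet> x = d} {x. d < c \<bullet> x}"
    unfolding open_side_def by (rule exI[of _ "- c"], rule exI[of _ "- d"]) (use assms in auto)
  moreover assume "H = {x. c \<bullet> x < d} \<or> H = {x. d < c \<bullet> x}"
  ultimately show "open_side {x. c \<bullet> x = d} H" by blast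
qed

section \<open>Normal form of a line given by its angle and its \<open>X\<close>-intercept\<close>

lemma cot_strict_antimono:
  fixes x y :: real
  assumes "0 < x" "x < y" "y < pi"
  shows "cot y < cot x"
proof -
  have s: "sin x > 0" "sin y > 0" "sin (y - x) > 0" using assms by (auto intro: sin_gt_zero)
  then have "cot x - cot y = sin (y - x) / (sin x * sin y)"
    by (simp add: cot_def sin_diff field_simps)
  also have "\<dots> > 0" using s by simp
  finally show ?thesis by simp
qed

text \<open>Eliminates the parameter by dividing by \<open>sin \<theta> > 0\<close>. Solving for the
  first coordinate rather than the second keeps vertical lines within the same form.\<close>

lemma has_angle_imp_eq_cot:
  assumes "has_angle l \<theta>" "0 < \<theta>" "vector [x, 0] \<in> l"
  shows "l = {p. p $ 1 - cot \<theta> * p $ 2 = x}"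
proof -
  obtain p where l: "l = {p + s *\<^sub>R vector [cos \<theta>, sin \<theta>] | s. True}" and "\<theta> < pi"
    using assms(1) unfolding has_angle_def by blast
  have s: "sin \<theta> > 0" using \<open>0 < \<theta>\<close> \<open>\<theta> < pi\<close> by (rule sin_gt_zero)
  obtain r where "(vector [x, 0] :: real^2) = p + r *\<^sub>R vector [cos \<theta>, sin \<theta>]"
    using assms(3) l by auto
  then have p: "p $ 1 = x - r * cos \<theta>" "p $ 2 = - r * sin \<theta>"
    by (auto simp: vec_eq_iff forall_2)
  show ?thesis
  proof (intro set_eqI iffI)
    fix q assume "q \<in> l"
    then show "q \<in> {p. p $ 1 - cot \<theta> * p $ 2 = x}"
      using s p by (auto simp: l cot_def field_simps)
  next
    fix q :: "real^2" assume "q \<in> {p. p $ 1 - cot \<theta> * p $ 2 = x}"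
    then have "q = p + (r + q $ 2 / sin \<theta>) *\<^sub>R vector [cos \<theta>, sin \<theta>]"
      using s by (simp add: vec_eq_iff forall_2 p cot_def field_simps)
    then show "q \<in> l" unfolding l by blast
  qed
qed

section \<open>Arrangements in coordinates\<close>

locale slope_arrangement =
  fixes n :: nat and L :: "nat \<Rightarrow> (real^2) set" and M X :: "nat \<Rightarrow> real"
  assumes line_eq: "i \<in> {1..n} \<Longrightarrow> L i = {p. p $ 1 - M i * p $ 2 = X i}"
    and X_pos: "i \<in> {1..n} \<Longrightarrow> 0 < X i"
    and M_anti: "i \<in> {1..n} \<Longrightarrow> j \<in> {1..n} \<Longrightarrow> i < j \<Longrightarrow> M j < M i"
    and arrangement: "line_arrangement (L ` {1..n})"
begin

definition height :: "nat \<Rightarrow> real^2 \<Rightarrow> real" where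
  "height i v = v $ 1 - M i * v $ 2 - X i"

text \<open>Solves the two line equations. Only distinct indices matter: for \<open>i = j\<close>
  the quotient is 0 / 0 = 0 and the value carries no meaning.\<close>

definition meet :: "nat \<Rightarrow> nat \<Rightarrow> real^2" where
  "meet i j = (let y = (X j - X i) / (M i - M j) in vector [X i + M i * y, y])"

definition side :: "nat \<Rightarrow> nat \<Rightarrow> nat \<Rightarrow> real" where
  "side i j k = height i (meet j k)"

lemma M_less_iff: "i \<in> {1..n} \<Longrightarrow> j \<in> {1..n} \<Longrightarrow> M i < M j \<longleftrightarrow> j < i"
  by (metis M_anti less_asym less_irrefl linorder_neqE_nat)

lemma M_eq_iff: "i \<in> {1..n} \<Longrightarrow> j \<in> {1..n} \<Longrightarrow> M i = M j \<longleftrightarrow> i = j"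
  by (metis M_less_iff less_irrefl linorder_neqE_nat)

lemma mem_line_iff: "i \<in> {1..n} \<Longrightarrow> p \<in> L i \<longleftrightarrow> height i p = 0"
  by (auto simp: line_eq height_def)

lemma Int_lines:
  assumes "i \<in> {1..n}" "j \<in> {1..n}" "i \<noteq> j"
  shows "L i \<inter> L j = {meet i j}"
proof -
  have ne: "M i - M j \<noteq> 0" using assms by (simp add: M_eq_iff)
  show ?thesis
  proof (intro set_eqI iffI)
    fix p assume "p \<in> L i \<inter> L j"
    then have p: "p $ 1 - M i * p $ 2 = X i" "p $ 1 - M j * p $ 2 = X j"
      using assms by (auto simp: line_eq)
    then have y: "p $ 2 = (X j - X i) / (M i - M j)"
      using ne by (simp add: field_simps)
    then have "p $ 1 = X i + M i * ((X j - X i) / (M i - M j))" using p by simp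
    with y show "p \<in> {meet i j}" by (simp add: meet_def vec_eq_iff forall_2 Let_def)
  next
    fix p assume "p \<in> {meet i j}"
    then show "p \<in> L i \<inter> L j"
      using ne assms by (simp add: line_eq meet_def Let_def field_simps)
  qed
qed

text \<open>\<open>arrangement\<close> concerns the set of lines only, so that different indices
  give different lines has to be derived: otherwise a whole line would be the single point
  \<open>meet i j\<close>.\<close>

lemma inj_on_L: "inj_on L {1..n}"
proof (rule inj_onI, rule ccontr)
  fix i j assume ij: "i \<in> {1..n}" "j \<in> {1..n}" "L i = L j" "i \<noteq> j"
  have "vector [X i, 0] \<in> L i" "vector [X i + M i, 1] \<in> L i"
    using ij(1) by (simp_all add: line_eq)
  then have "(vector [X i, 0] :: real^2) = vector [X i + M i, 1]"
    using Int_lines[OF ij(1,2,4)] ij(3) by auto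
  then show False by (simp add: vec_eq_iff forall_2)
qed

lemma vertices_lines:
  assumes "J \<subseteq> {1..n}"
  shows "vertices (L ` J) = {meet j k | j k. j \<in> J \<and> k \<in> J \<and> j \<noteq> k}"
proof (intro set_eqI iffI)
  fix p assume "p \<in> vertices (L ` J)"
  then obtain j k where jk: "j \<in> J" "k \<in> J" "L j \<noteq> L k" "p \<in> L j \<inter> L k"
    unfolding vertices_def by blast
  then have "j \<noteq> k" by auto
  then have "p = meet j k" using Int_lines[of j k] jk assms by blast
  then show "p \<in> {meet j k | j k. j \<in> J \<and> k \<in> J \<and> j \<noteq> k}" using jk \<open>j \<noteq> k\<close> by blast
next
  fix p assume "p \<in> {meet j k | j k. j \<in> J \<and> k \<in> J \<and> j \<noteq> k}"
  then obtain j k where jk: "j \<in> J" "k \<in> J" "j \<noteq> k" "p = meet j k" by blast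
  then have "p \<in> L j" "p \<in> L k" using Int_lines[of j k] assms by blast+
  moreover have "L j \<noteq> L k" using inj_onD[OF inj_on_L, of j k] jk assms by blast
  ultimately show "p \<in> vertices (L ` J)" unfolding vertices_def using jk by blast
qed

section \<open>Orientation of triples of lines\<close>

lemma side_nonzero:
  assumes "i \<in> {1..n}" "j \<in> {1..n}" "k \<in> {1..n}" "i \<noteq> j" "i \<noteq> k" "j \<noteq> k"
  shows "side i j k \<noteq> 0"
proof
  assume "side i j k = 0"
  then have "meet j k \<in> L i \<inter> L j \<inter> L k"
    using Int_lines[of j k] assms by (auto simp: side_def mem_line_iff)
  moreover have "L i \<noteq> L j" "L i \<noteq> L k" "L j \<noteq> L k"
    using inj_onD[OF inj_on_L] assms by blast+
  ultimately show False
    using arrangement assms unfolding line_arrangement_def by blast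
qed

text \<open>Clearing the denominator of \<open>meet\<close> leaves the determinant with rows
  \<open>(1, M, X)\<close> for the indices \<open>i\<close>, \<open>j\<close>,
  \<open>k\<close>.\<close>

lemma side_mult_slope_diff:
  assumes "j \<in> {1..n}" "k \<in> {1..n}" "j \<noteq> k"
  shows "side i j k * (M j - M k) = (X j - X i) * (M j - M k) + (M j - M i) * (X k - X j)"
proof -
  define y where "y = (X k - X j) / (M j - M k)"
  have y: "y * (M j - M k) = X k - X j" using assms by (simp add: y_def M_eq_iff)
  have side: "side i j k = X j - X i + (M j - M i) * y"
    by (simp add: side_def height_def meet_def Let_def y_def[symmetric] algebra_simps)
  show ?thesis unfolding side y[symmetric] by (simp add: algebra_simps)
qed

text \<open>The determinant is invariant under cyclic rotation of its rows.\<close>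

lemma side_rotate:
  assumes "i \<in> {1..n}" "j \<in> {1..n}" "k \<in> {1..n}" "i \<noteq> j" "j \<noteq> k"
  shows "side i j k * (M j - M k) = side k i j * (M i - M j)"
  unfolding side_mult_slope_diff[OF assms(2,3,5)] side_mult_slope_diff[OF assms(1,2,4)]
  by (simp add: algebra_simps)

section \<open>Sides, separation and superscripts in terms of signs of heights\<close>

lemma open_side_line_iff:
  assumes "i \<in> {1..n}"
  shows "open_side (L i) H \<longleftrightarrow> H = {v. height i v < 0} \<or> H = {v. 0 < height i v}"
proof -
  define c :: "real^2" where "c = vector [1, - M i]"
  have c: "c \<bullet> v = v $ 1 - M i * v $ 2" for v by (simp add: c_def inner_vec_def sum_2)
  have "c \<noteq> 0" by (simp add: c_def vec_eq_iff forall_2)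
  moreover have "L i = {v. c \<bullet> v = X i}" using assms by (simp add: line_eq c)
  ultimately have "open_side (L i) H \<longleftrightarrow> H = {v. c \<bullet> v < X i} \<or> H = {v. X i < c \<bullet> v}"
    using open_side_hyperplane_iff by simp
  then show ?thesis by (simp add: c height_def)
qed

lemma separates_origin_iff:
  assumes "i \<in> {1..n}"
  shows "separates (L i) 0 v \<longleftrightarrow> 0 < height i v"
proof
  have origin: "height i 0 < 0" using X_pos[OF assms] by (simp add: height_def)
  show "0 < height i v" if "separates (L i) 0 v"
  proof -
    obtain H K where "open_side (L i) H" "open_side (L i) K" "H \<inter> K = {}" "0 \<in> H" "v \<in> K"
      using \<open>separates (L i) 0 v\<close> unfolding separates_def by blast
    then show ?thesis using origin unfolding open_side_line_iff[OF assms] by auto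
  qed
  show "separates (L i) 0 v" if "0 < height i v"
    unfolding separates_def open_side_line_iff[OF assms]
    by (rule exI[of _ "{v. height i v < 0}"], rule exI[of _ "{v. 0 < height i v}"])
      (use that origin in auto)
qed

text \<open>The inequalities are weak because for \<open>i \<in> J\<close> vertices on
  \<open>L i\<close> itself are allowed. Strictness is regained from \<open>side_nonzero\<close> for
  three distinct indices.\<close>

lemma vertices_one_side:
  assumes "i \<in> {1..n}" "J \<subseteq> {1..n}" "line_at_infinity (L i) (L ` J)"
  shows "(\<forall>j\<in>J. \<forall>k\<in>J. j \<noteq> k \<longrightarrow> side i j k \<le> 0) \<or> (\<forall>j\<in>J. \<forall>k\<in>J. j \<noteq> k \<longrightarrow> 0 \<le> side i j k)"
proof -
  obtain H where "open_side (L i) H" "vertices (L ` J) \<subseteq> (if L i \<in> L ` J then H \<union> L i else H)"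
    using assms(3) unfolding line_at_infinity_def by blast
  then have H: "H = {v. height i v < 0} \<or> H = {v. 0 < height i v}"
    and mem: "\<forall>j\<in>J. \<forall>k\<in>J. j \<noteq> k \<longrightarrow> meet j k \<in> H \<union> L i"
    unfolding vertices_lines[OF assms(2)] open_side_line_iff[OF assms(1)]
    by (auto split: if_splits)
  have on_line: "p \<in> L i \<longleftrightarrow> height i p = 0" for p using assms(1) by (rule mem_line_iff)
  from H show ?thesis
  proof
    assume "H = {v. height i v < 0}"
    then have "\<forall>j\<in>J. \<forall>k\<in>J. j \<noteq> k \<longrightarrow> side i j k \<le> 0"
      using mem by (fastforce simp: on_line side_def)
    then show ?thesis ..
  next
    assume "H = {v. 0 < height i v}"
    then have "\<forall>j\<in>J. \<forall>k\<in>J. j \<noteq> k \<longrightarrow> 0 \<le> side i j k"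
      using mem by (fastforce simp: on_line side_def)
    then show ?thesis ..
  qed
qed

text \<open>The value 1 is the default branch of \<open>superscript\<close>, so it means that some
  reference vertex fails to be separated from the origin.\<close>

lemma superscript_eq_1_iff:
  assumes "\<sigma> l \<in> {1..n}" "\<sigma> ` (if l \<le> 3 then {1,2,3} - {l} else {1..<l}) \<subseteq> {1..n}"
  shows "superscript L \<sigma> l = 1 \<longleftrightarrow>
    (\<exists>p\<in>(if l \<le> 3 then {1,2,3} - {l} else {1..<l}).
     \<exists>q\<in>(if l \<le> 3 then {1,2,3} - {l} else {1..<l}).
       \<sigma> p \<noteq> \<sigma> q \<and> side (\<sigma> l) (\<sigma> p) (\<sigma> q) \<le> 0)"
proof -
  define I where "I = (if l \<le> 3 then {1,2,3} - {l} else {1..<l})"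
  have "superscript L \<sigma> l = 1 \<longleftrightarrow> \<not> (\<forall>v\<in>vertices (L ` \<sigma> ` I). 0 < height (\<sigma> l) v)"
    using assms(1) by (simp add: superscript_def reference_lines_def I_def separates_origin_iff)
  also have "\<dots> \<longleftrightarrow> (\<exists>p\<in>I. \<exists>q\<in>I. \<sigma> p \<noteq> \<sigma> q \<and> side (\<sigma> l) (\<sigma> p) (\<sigma> q) \<le> 0)"
    unfolding vertices_lines[OF assms(2)[folded I_def]] side_def not_less[symmetric] by auto
  finally show ?thesis unfolding I_def .
qed

section \<open>Sign criteria along an infinity permutation\<close>

context
  fixes \<sigma> :: "nat \<Rightarrow> nat"
  assumes three: "3 \<le> n" and sigma: "infinity_permutation n L \<sigma>"
begin

lemma sigma_mem: "\<sigma> p \<in> {1..n} \<longleftrightarrow> p \<in> {1..n}"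
  using sigma unfolding infinity_permutation_def by (meson permutes_in_image)

text \<open>The simplifier turns \<open>1\<close> into \<open>Suc 0\<close>, so the rule is stored
  in that form. Deleting \<open>atLeastAtMost_iff\<close> below keeps memberships intact so that it
  can fire.\<close>

lemmas [simp] = sigma_mem[unfolded One_nat_def]

lemma sigma_eq_iff [simp]: "\<sigma> p = \<sigma> q \<longleftrightarrow> p = q"
  using sigma unfolding infinity_permutation_def by (meson permutes_inj inj_eq)

lemma sigma_image: "\<sigma> ` {1..n} = {1..n}"
  using sigma unfolding infinity_permutation_def by (meson permutes_image)

lemma side_sigma_nonzero:
  assumes "i \<in> {1..n}" "j \<in> {1..n}" "k \<in> {1..n}" "i \<noteq> j" "i \<noteq> k" "j \<noteq> k"
  shows "side (\<sigma> i) (\<sigma> j) (\<sigma> k) \<noteq> 0"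
  using assms by (simp add: side_nonzero del: atLeastAtMost_iff)

text \<open>All vertices of the preceding lines lie on one side of \<open>L (\<sigma> q)\<close>, so
  any single pair of preceding positions decides the superscript.\<close>

lemma superscript_eq_1_iff_side:
  assumes "q \<le> n" "p \<in> {1..<q}" "r \<in> {1..<q}" "p \<noteq> r"
  shows "superscript L \<sigma> q = 1 \<longleftrightarrow> side (\<sigma> q) (\<sigma> p) (\<sigma> r) < 0"
proof -
  have q: "3 \<le> q" using assms by auto
  have "{1..<q} \<subseteq> {1..n}" using assms(1) by auto
  then have sub: "\<sigma> ` {1..<q} \<subseteq> {1..n}" by (metis image_mono sigma_image)
  \<comment> \<open>Two distinct positions precede \<open>q\<close>, hence \<open>3 \<le> q\<close>;
    at \<open>q = 3\<close> both branches of the reference set are the positions 1 and 2.\<close>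
  have ref: "(if q \<le> 3 then {1,2,3} - {q} else {1..<q}) = {1..<q}"
    using q by (auto split: if_splits)
  have "q \<in> {1..n}" "q \<in> {2..n}" using assms(1) q by auto
  then have qn: "\<sigma> q \<in> {1..n}" by (subst sigma_mem)
  have "line_at_infinity (L (\<sigma> q)) (L ` \<sigma> ` {1..<q})"
    using sigma \<open>q \<in> {2..n}\<close> unfolding infinity_permutation_def by blast
  note one = vertices_one_side[OF qn sub this]
  have nz: "side (\<sigma> q) (\<sigma> x) (\<sigma> y) \<noteq> 0" if "x \<in> {1..<q}" "y \<in> {1..<q}" "x \<noteq> y" for x y
    using that assms(1) by (intro side_sigma_nonzero) auto
  have "superscript L \<sigma> q = 1 \<longleftrightarrow>
      (\<exists>p\<in>{1..<q}. \<exists>r\<in>{1..<q}. p \<noteq> r \<and> side (\<sigma> q) (\<sigma> p) (\<sigma> r) \<le> 0)"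
    using superscript_eq_1_iff[of \<sigma> q] qn sub unfolding ref by simp
  also have "\<dots> \<longleftrightarrow> side (\<sigma> q) (\<sigma> p) (\<sigma> r) < 0"
  proof
    assume "\<exists>p\<in>{1..<q}. \<exists>r\<in>{1..<q}. p \<noteq> r \<and> side (\<sigma> q) (\<sigma> p) (\<sigma> r) \<le> 0"
    then obtain x y where xy: "x \<in> {1..<q}" "y \<in> {1..<q}" "x \<noteq> y" "side (\<sigma> q) (\<sigma> x) (\<sigma> y) \<le> 0"
      by blast
    then have "side (\<sigma> q) (\<sigma> x) (\<sigma> y) < 0" using nz by (simp add: less_le)
    then have "side (\<sigma> q) (\<sigma> p) (\<sigma> r) \<le> 0"
      using one xy assms by (metis image_eqI not_less sigma_eq_iff)
    then show "side (\<sigma> q) (\<sigma> p) (\<sigma> r) < 0" using nz assms by (simp add: less_le)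
  next
    assume "side (\<sigma> q) (\<sigma> p) (\<sigma> r) < 0"
    then show "\<exists>p\<in>{1..<q}. \<exists>r\<in>{1..<q}. p \<noteq> r \<and> side (\<sigma> q) (\<sigma> p) (\<sigma> r) \<le> 0"
      using assms by (meson less_imp_le)
  qed
  finally show ?thesis .
qed

text \<open>The superscript +1 exhibits a vertex on the origin's side of
  \<open>L (\<sigma> t)\<close>, so the common side of all vertices must be the negative
  one.\<close>

lemma line_at_infinity_iff_side:
  assumes t: "t \<in> {1..n}" and "superscript L \<sigma> t = 1"
  shows "line_at_infinity (L (\<sigma> t)) (L ` {1..n}) \<longleftrightarrow>
    (\<forall>p\<in>{1..n} - {t}. \<forall>q\<in>{1..n} - {t}. p \<noteq> q \<longrightarrow> side (\<sigma> t) (\<sigma> p) (\<sigma> q) < 0)"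
proof
  have tn: "\<sigma> t \<in> {1..n}" using t by (subst sigma_mem)
  have nz: "side (\<sigma> t) (\<sigma> p) (\<sigma> q) \<noteq> 0"
    if "p \<in> {1..n} - {t}" "q \<in> {1..n} - {t}" "p \<noteq> q" for p q
    using that t by (intro side_sigma_nonzero) auto
  show "\<forall>p\<in>{1..n} - {t}. \<forall>q\<in>{1..n} - {t}. p \<noteq> q \<longrightarrow> side (\<sigma> t) (\<sigma> p) (\<sigma> q) < 0"
    if "line_at_infinity (L (\<sigma> t)) (L ` {1..n})"
  proof -
    \<comment> \<open>The reference positions of \<open>t\<close>. For \<open>t < 3\<close> they
      include later positions, which exist because \<open>3 \<le> n\<close>.\<close>
    define I where "I = (if t \<le> 3 then {1,2,3} - {t} else {1..<t})"
    have I: "I \<subseteq> {1..n} - {t}" using t three by (auto simp: I_def)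
    then have "I \<subseteq> {1..n}" by blast
    then have "\<sigma> ` I \<subseteq> {1..n}" by (metis image_mono sigma_image)
    then obtain x y where xy: "x \<in> I" "y \<in> I" "x \<noteq> y" "side (\<sigma> t) (\<sigma> x) (\<sigma> y) \<le> 0"
      using superscript_eq_1_iff[of \<sigma> t] tn assms(2) unfolding I_def[symmetric] by auto
    then have "side (\<sigma> t) (\<sigma> x) (\<sigma> y) < 0" using nz I by (simp add: less_le subset_iff)
    moreover have "\<sigma> x \<in> {1..n}" "\<sigma> y \<in> {1..n}" "\<sigma> x \<noteq> \<sigma> y"
      using xy I by (simp_all del: atLeastAtMost_iff add: subset_iff)
    \<comment> \<open>One strictly negative value excludes the nonnegative alternative of
      \<open>vertices_one_side\<close>.\<close>
    ultimately have all: "side (\<sigma> t) j k \<le> 0" if "j \<in> {1..n}" "k \<in> {1..n}" "j \<noteq> k" for j k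
      using vertices_one_side[OF tn subset_refl \<open>line_at_infinity _ _\<close>] that not_less by blast
    show ?thesis
    proof (intro ballI impI)
      fix p q assume pq: "p \<in> {1..n} - {t}" "q \<in> {1..n} - {t}" "p \<noteq> q"
      then have "side (\<sigma> t) (\<sigma> p) (\<sigma> q) \<le> 0"
        by (intro all) (simp_all del: atLeastAtMost_iff)
      then show "side (\<sigma> t) (\<sigma> p) (\<sigma> q) < 0" using nz[OF pq] by simp
    qed
  qed
  assume neg: "\<forall>p\<in>{1..n} - {t}. \<forall>q\<in>{1..n} - {t}. p \<noteq> q \<longrightarrow> side (\<sigma> t) (\<sigma> p) (\<sigma> q) < 0"
  have "meet j k \<in> {v. height (\<sigma> t) v < 0} \<union> L (\<sigma> t)"
    if "j \<in> {1..n}" "k \<in> {1..n}" "j \<noteq> k" for j k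
  proof (cases "j = \<sigma> t \<or> k = \<sigma> t")
    case True
    \<comment> \<open>Such a vertex lies on \<open>L (\<sigma> t)\<close>, which is permitted for a
      member of the arrangement.\<close>
    then show ?thesis using Int_lines[OF that] by blast
  next
    case False
    have "j \<in> \<sigma> ` {1..n}" "k \<in> \<sigma> ` {1..n}" unfolding sigma_image by (rule that)+
    then obtain p q where pq: "p \<in> {1..n}" "q \<in> {1..n}" "j = \<sigma> p" "k = \<sigma> q" by blast
    then have "p \<in> {1..n} - {t}" "q \<in> {1..n} - {t}" "p \<noteq> q" using False that by blast+
    then have "side (\<sigma> t) j k < 0" using neg pq(3,4) by blast
    then show ?thesis by (simp add: side_def)
  qed
  then have "vertices (L ` {1..n}) \<subseteq> {v. height (\<sigma> t) v < 0} \<union> L (\<sigma> t)"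
    unfolding vertices_lines[OF subset_refl] by blast
  moreover have "L (\<sigma> t) \<in> L ` {1..n}" using tn by blast
  ultimately show "line_at_infinity (L (\<sigma> t)) (L ` {1..n})"
    unfolding line_at_infinity_def open_side_line_iff[OF tn]
    using arrangement by (auto simp: insert_absorb simp del: atLeastAtMost_iff)
qed

text \<open>Rotation moves the last position \<open>q\<close> to the front, where the sign is its
  superscript. The two slope factors agree in sign exactly when \<open>\<sigma> p\<close> lies
  between \<open>\<sigma> t\<close> and \<open>\<sigma> q\<close>.\<close>

lemma side_less_0_iff_between:
  assumes "q \<le> n" "p \<in> {1..<q}" "t \<in> {1..<q}" "p \<noteq> t"
  shows "side (\<sigma> t) (\<sigma> p) (\<sigma> q) < 0 \<longleftrightarrow>
    (superscript L \<sigma> q = 1 \<longleftrightarrow> \<sigma> t < \<sigma> p \<and> \<sigma> p < \<sigma> q \<or> \<sigma> q < \<sigma> p \<and> \<sigma> p < \<sigma> t)"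
proof -
  have tpq: "t \<in> {1..n}" "p \<in> {1..n}" "q \<in> {1..n}" and ne: "t \<noteq> p" "p \<noteq> q" "q \<noteq> t" using assms by auto
  then have mem: "\<sigma> t \<in> {1..n}" "\<sigma> p \<in> {1..n}" "\<sigma> q \<in> {1..n}"
    by (simp_all del: atLeastAtMost_iff)
  have sup: "superscript L \<sigma> q = 1 \<longleftrightarrow> side (\<sigma> q) (\<sigma> t) (\<sigma> p) < 0"
    using assms by (intro superscript_eq_1_iff_side) auto
  have "side (\<sigma> t) (\<sigma> p) (\<sigma> q) \<noteq> 0" "side (\<sigma> q) (\<sigma> t) (\<sigma> p) \<noteq> 0"
    using side_sigma_nonzero tpq ne by metis+
  moreover have "side (\<sigma> t) (\<sigma> p) (\<sigma> q) * (M (\<sigma> p) - M (\<sigma> q))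
      = side (\<sigma> q) (\<sigma> t) (\<sigma> p) * (M (\<sigma> t) - M (\<sigma> p))"
    using mem ne by (intro side_rotate) (simp_all del: atLeastAtMost_iff)
  moreover have "M (\<sigma> p) - M (\<sigma> q) > 0 \<longleftrightarrow> \<sigma> p < \<sigma> q" "M (\<sigma> p) - M (\<sigma> q) < 0 \<longleftrightarrow> \<sigma> q < \<sigma> p"
    "M (\<sigma> t) - M (\<sigma> p) > 0 \<longleftrightarrow> \<sigma> t < \<sigma> p" "M (\<sigma> t) - M (\<sigma> p) < 0 \<longleftrightarrow> \<sigma> p < \<sigma> t"
    using mem by (simp_all add: M_less_iff del: atLeastAtMost_iff)
  moreover have "\<sigma> p < \<sigma> q \<or> \<sigma> q < \<sigma> p" "\<sigma> t < \<sigma> p \<or> \<sigma> p < \<sigma> t"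
    using ne by (metis sigma_eq_iff linorder_neqE_nat)+
  ultimately show ?thesis
    unfolding sup by (smt (verit) mult_pos_pos mult_neg_neg mult_pos_neg mult_neg_pos)
qed

lemma line_at_infinity_iff_between:
  assumes t: "t \<in> {1..n}" and sup: "superscript L \<sigma> t = 1"
  shows "line_at_infinity (L (\<sigma> t)) (L ` {1..n}) \<longleftrightarrow>
    (\<forall>q\<in>{t<..n}. \<forall>p\<in>{1..<q} - {t}.
      superscript L \<sigma> q = 1 \<longleftrightarrow> \<sigma> t < \<sigma> p \<and> \<sigma> p < \<sigma> q \<or> \<sigma> q < \<sigma> p \<and> \<sigma> p < \<sigma> t)"
    (is "_ \<longleftrightarrow> ?between")
proof -
  let ?neg = "\<lambda>p q. side (\<sigma> t) (\<sigma> p) (\<sigma> q) < 0"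
  have comm: "?neg q p \<longleftrightarrow> ?neg p q" if "p \<in> {1..n}" "q \<in> {1..n}" "p \<noteq> q" for p q
  proof -
    have "meet (\<sigma> p) (\<sigma> q) = meet (\<sigma> q) (\<sigma> p)"
      using Int_lines[of "\<sigma> p" "\<sigma> q"] Int_lines[of "\<sigma> q" "\<sigma> p"] that
      by (simp add: Int_commute del: atLeastAtMost_iff)
    then show ?thesis by (simp add: side_def)
  qed
  have "line_at_infinity (L (\<sigma> t)) (L ` {1..n}) \<longleftrightarrow>
      (\<forall>p\<in>{1..n} - {t}. \<forall>q\<in>{1..n} - {t}. p \<noteq> q \<longrightarrow> ?neg p q)"
    using assms by (rule line_at_infinity_iff_side)
  also have "\<dots> \<longleftrightarrow> (\<forall>q\<in>{1..n} - {t}. \<forall>p\<in>{1..<q} - {t}. ?neg p q)"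
  proof (intro iffI ballI impI)
    fix p q
    assume *: "\<forall>q\<in>{1..n} - {t}. \<forall>p\<in>{1..<q} - {t}. ?neg p q"
      and pq: "p \<in> {1..n} - {t}" "q \<in> {1..n} - {t}" "p \<noteq> q"
    show "?neg p q"
    proof (cases "p < q")
      case True
      then show ?thesis using * pq by auto
    next
      case False
      then have "?neg q p" using * pq by auto
      then show ?thesis using comm[of p q] pq by auto
    qed
  qed auto
  also have "\<dots> \<longleftrightarrow> (\<forall>q\<in>{t<..n}. \<forall>p\<in>{1..<q} - {t}. ?neg p q)"
  proof (intro iffI ballI)
    fix p q
    assume *: "\<forall>q\<in>{t<..n}. \<forall>p\<in>{1..<q} - {t}. ?neg p q"
      and pq: "q \<in> {1..n} - {t}" "p \<in> {1..<q} - {t}"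
    show "?neg p q"
    proof (cases "t < q")
      case True
      then show ?thesis using * pq by auto
    next
      case False
      \<comment> \<open>Both positions precede \<open>t\<close>, so this sign is the superscript +1
        at \<open>t\<close> itself.\<close>
      then show ?thesis using superscript_eq_1_iff_side[of t p q] sup t pq by auto
    qed
  qed auto
  also have "\<dots> \<longleftrightarrow> ?between"
    using t by (intro ball_cong refl side_less_0_iff_between) auto
  finally show ?thesis .
qed

end

end

lemma standard_position_imp_slope_arrangement:
  assumes "standard_position n L"
  obtains M X where "slope_arrangement n L M X"
proof -
  obtain \<theta> where \<theta>: "\<And>i. i \<in> {1..n} \<Longrightarrow> has_angle (L i) (\<theta> i) \<and> 0 < \<theta> i"
    and mono: "strict_mono_on {1..n} \<theta>"
    using assms unfolding standard_position_def by blast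
  obtain X where X: "\<And>i. i \<in> {1..n} \<Longrightarrow> 0 < X i \<and> vector [X i, 0] \<in> L i"
    using assms unfolding standard_position_def by metis
  have "slope_arrangement n L (\<lambda>i. cot (\<theta> i)) X"
  proof
    show "L i = {p. p $ 1 - cot (\<theta> i) * p $ 2 = X i}" if "i \<in> {1..n}" for i
      using has_angle_imp_eq_cot \<theta> X that by blast
    show "cot (\<theta> j) < cot (\<theta> i)" if "i \<in> {1..n}" "j \<in> {1..n}" "i < j" for i j
      using cot_strict_antimono \<theta> strict_mono_onD[OF mono] that unfolding has_angle_def by blast
    show "line_arrangement (L ` {1..n})" using assms unfolding standard_position_def by blast
  qed (use X in blast)
  then show thesis by (rule that)
qed

section \<open>Unfolding the betweenness criterion\<close>

text \<open>Betweenness at \<open>u\<close> puts every symbol before \<open>u\<close>, other than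
  that of \<open>t\<close>, between those of \<open>t\<close> and \<open>u\<close>. The criterion
  then reduces to plain comparisons. The values are integers so that the mirrored case is obtained
  from negated symbols.\<close>

lemma between_iff_last_pos_greater:
  fixes s :: "nat \<Rightarrow> int" and a :: "nat \<Rightarrow> int"
  assumes a: "\<And>i. i \<in> {t<..n} \<Longrightarrow> a i = 1 \<or> a i = -1"
    and inj: "\<And>i j. s i = s j \<longleftrightarrow> i = j"
    and u: "t < u" "u \<le> n" "a u = 1" and last: "\<not> (\<exists>w. u < w \<and> w \<le> n \<and> a w = 1)"
    and less: "s t < s u" and t: "1 \<le> t"
  shows "(\<forall>q\<in>{t<..n}. \<forall>p\<in>{1..<q} - {t}.
        a q = 1 \<longleftrightarrow> s t < s p \<and> s p < s q \<or> s q < s p \<and> s p < s t) \<longleftrightarrow>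
      ((\<forall>i\<in>pos a {t<..n}. s t < s i) \<and> strict_mono_on (pos a {t<..n}) s) \<and>
      (\<forall>i\<in>neg a {t<..n}. \<forall>j\<in>pos a {t<..n}. s i < s j) \<and>
      (\<forall>m\<in>{1..<t}. s t < s m \<and>
         (\<forall>i\<in>neg a {t<..n}. s i < s m) \<and> (\<forall>j\<in>pos a {t<..n}. s m < s j)) \<and>
      ((\<forall>i\<in>neg a {t<..<u}. s t < s i) \<and> strict_antimono_on (neg a {t<..<u}) s) \<and>
      ((\<forall>i\<in>{u<..n}. a i = -1) \<and>
       strict_mono_on {i\<in>{u<..n}. s i < s t} s \<and>
       strict_antimono_on {i\<in>{u<..n}. s t < s i} s \<and>
       (\<forall>i\<in>{u<..n}. s t < s i \<longrightarrow> (\<forall>j\<in>neg a {t<..<u}. s i < s j)))"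
    (is "?between \<longleftrightarrow> ?A \<and> ?B \<and> ?C \<and> ?D \<and> ?E")
proof
  have after: "a i = -1" if "u < i" "i \<le> n" for i using a[of i] last that u by auto
  assume btw: ?between
  have P: "s t < s p \<and> s p < s q \<or> s q < s p \<and> s p < s t"
    if "t < q" "q \<le> n" "a q = 1" "1 \<le> p" "p < q" "p \<noteq> t" for p q
    using btw that by auto
  have N: "\<not> (s t < s p \<and> s p < s q \<or> s q < s p \<and> s p < s t)"
    if "t < q" "q \<le> n" "a q = -1" "1 \<le> p" "p < q" "p \<noteq> t" for p q
    using btw[rule_format, of q p] that by auto
  have below: "s t < s p \<and> s p < s u" if "1 \<le> p" "p < u" "p \<noteq> t" for p
    using P[of u p] that u less by auto
  \<comment> \<open>A position after \<open>t\<close> with superscript +1 is \<open>u\<close> or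
    precedes it, as \<open>u\<close> is the last one.\<close>
  have gt: "s t < s i" if "t < i" "i \<le> n" "a i = 1" for i
    using below[of i] last that less t by (metis le_trans less_imp_le linorder_neqE_nat less_irrefl)
  have PP: "s p < s q" if "t < q" "q \<le> n" "a q = 1" "1 \<le> p" "p < q" "p \<noteq> t" for p q
    using P[OF that] gt that by fastforce
  \<comment> \<open>Not being between means that a later symbol never passes an earlier one when
    moving away from \<open>s t\<close>. \<open>NN\<close> and \<open>NN'\<close> treat the two
    sides of \<open>s t\<close>.\<close>
  have NN: "s q < s p" if "t < q" "q \<le> n" "a q = -1" "1 \<le> p" "p < q" "p \<noteq> t" "s t < s p" for p q
    using N[OF that(1-6)] inj[of p q] that by auto
  have NN': "s p < s q" if "t < q" "q \<le> n" "a q = -1" "1 \<le> p" "p < q" "p \<noteq> t" "s p < s t" for p q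
    using N[OF that(1-6)] inj[of p q] that by auto
  show "?A \<and> ?B \<and> ?C \<and> ?D \<and> ?E"
  proof (intro conjI)
    show "\<forall>i\<in>pos a {t<..n}. s t < s i" using gt by (auto simp: pos_def)
    show "strict_mono_on (pos a {t<..n}) s"
      using PP t by (auto simp: pos_def monotone_on_def)
    show ?B
    proof (intro ballI)
      fix i j assume "i \<in> neg a {t<..n}" "j \<in> pos a {t<..n}"
      then have ij: "t < i" "i \<le> n" "a i = -1" "t < j" "j \<le> n" "a j = 1"
        by (auto simp: pos_def neg_def)
      then consider "i < j" | "j < i" by (metis linorder_neqE_nat one_neq_neg_one)
      then show "s i < s j" using PP[of j i] NN[of i j] gt[of j] ij t by cases auto
    qed
    show ?C
      using below NN PP t u by (auto simp: pos_def neg_def)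
    show "\<forall>i\<in>neg a {t<..<u}. s t < s i" using below t by (auto simp: neg_def)
    show "strict_antimono_on (neg a {t<..<u}) s"
      using below NN t u by (auto simp: neg_def monotone_on_def)
    show "\<forall>i\<in>{u<..n}. a i = -1" using after by auto
    show "strict_mono_on {i\<in>{u<..n}. s i < s t} s"
      using after NN' t u by (auto simp: monotone_on_def)
    show "strict_antimono_on {i\<in>{u<..n}. s t < s i} s"
      using after NN t u by (auto simp: monotone_on_def)
    show "\<forall>i\<in>{u<..n}. s t < s i \<longrightarrow> (\<forall>j\<in>neg a {t<..<u}. s i < s j)"
      using after NN below t u by (auto simp: neg_def)
  qed
next
  assume R: "?A \<and> ?B \<and> ?C \<and> ?D \<and> ?E"
  then have A: ?A and B: ?B and C: ?C and D: ?D and E: ?E by blast+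
  have A1: "s t < s i" if "i \<in> pos a {t<..n}" for i using A that by blast
  have A2: "s i < s j" if "i \<in> pos a {t<..n}" "j \<in> pos a {t<..n}" "i < j" for i j
    using A that by (auto simp: monotone_on_def)
  have D1: "s t < s i" if "i \<in> neg a {t<..<u}" for i using D that by blast
  have D2: "s j < s i" if "i \<in> neg a {t<..<u}" "j \<in> neg a {t<..<u}" "i < j" for i j
    using D that by (auto simp: monotone_on_def)
  have E1: "s i < s j" if "u < i" "i < j" "j \<le> n" "s i < s t" "s j < s t" for i j
    using E that by (auto simp: monotone_on_def)
  have E2: "s j < s i" if "u < i" "i < j" "j \<le> n" "s t < s i" "s t < s j" for i j
    using E that by (auto simp: monotone_on_def)
  show ?between
  proof (intro ballI)
    fix q p assume "q \<in> {t<..n}" "p \<in> {1..<q} - {t}"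
    then have q: "t < q" "q \<le> n" and p: "1 \<le> p" "p < q" "p \<noteq> t" by auto
    have ne: "s p \<noteq> s q" "s p \<noteq> s t" "s q \<noteq> s t" using inj q p by auto
    consider (pos) "a q = 1" | (neg) "a q = -1" using a[of q] q by auto
    then show "a q = 1 \<longleftrightarrow> s t < s p \<and> s p < s q \<or> s q < s p \<and> s p < s t"
    proof cases
      case pos
      then have qp: "q \<in> pos a {t<..n}" and qu: "q \<le> u" using q last by (auto simp: pos_def)
      have "s t < s p \<and> s p < s q"
      proof (cases "p < t")
        case True
        then show ?thesis using C p qp by auto
      next
        case False
        then have tp: "t < p" using p by simp
        \<comment> \<open>Since \<open>p < q \<le> u\<close>, superscript -1 at \<open>p\<close>
          places it strictly before \<open>u\<close>, where \<open>D\<close> puts its symbol above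
          \<open>s t\<close>.\<close>
        then consider "p \<in> pos a {t<..n}" | "p \<in> neg a {t<..<u}" "p \<in> neg a {t<..n}"
          using a[of p] p q qu by (auto simp: pos_def neg_def)
        then show ?thesis using A1 A2 B D1 qp p by cases auto
      qed
      then show ?thesis using pos by simp
    next
      case neg
      then have qn: "q \<in> neg a {t<..n}" and qu: "q \<noteq> u" using q u by (auto simp: neg_def)
      consider "p < t" | "p \<in> pos a {t<..n}" | "p \<in> neg a {t<..<u}" | "u < p"
        using a[of p] p q u by (cases "p < t"; cases "u < p"; cases "p = u") (auto simp: pos_def neg_def)
      then have "\<not> (s t < s p \<and> s p < s q \<or> s q < s p \<and> s p < s t)"
      proof cases
        case 1
        then have "s t < s p" "s q < s p" using C p qn by auto
        then show ?thesis by simp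
      next
        case 2
        then have "s t < s p" "s q < s p" using A1 B qn by auto
        then show ?thesis by simp
      next
        case 3
        then have "s t < s p" using D1 by blast
        \<comment> \<open>If instead \<open>s q < s t\<close>, then \<open>s p\<close> lies outside
          the interval anyway.\<close>
        moreover have "s q < s p" if "s t < s q"
        proof (cases "q < u")
          case True
          then have "q \<in> neg a {t<..<u}" using qn by (auto simp: neg_def)
          then show ?thesis using D2 3 p by blast
        next
          case False
          then show ?thesis using E 3 qu q that by auto
        qed
        ultimately show ?thesis using ne by auto
      next
        case 4
        \<comment> \<open>Both positions come after \<open>u\<close>. If their symbols lie on
          opposite sides of \<open>s t\<close>, betweenness fails outright; otherwise
          \<open>E1\<close> or \<open>E2\<close> applies.\<close>
        then show ?thesis using E1[of p q] E2[of p q] p q by auto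
      qed
      then show ?thesis using neg by simp
    qed
  qed
qed

text \<open>With only -1 after \<open>t\<close>, no symbol \<open>s p\<close> may lie between
  \<open>s t\<close> and a later \<open>s q\<close>: on each side of \<open>s t\<close> the symbols
  close in on it. Positions \<open>p > t\<close> give the monotonicity conditions, positions
  \<open>p < t\<close> the other two.\<close>

lemma between_iff_no_pos:
  fixes s :: "nat \<Rightarrow> nat" and a :: "nat \<Rightarrow> int"
  assumes a: "\<And>i. i \<in> {t<..n} \<Longrightarrow> a i = 1 \<or> a i = -1"
    and inj: "\<And>i j. s i = s j \<longleftrightarrow> i = j"
    and none: "\<not> (\<exists>u. t < u \<and> u \<le> n \<and> a u = 1)" and t: "1 \<le> t"
  shows "(\<forall>q\<in>{t<..n}. \<forall>p\<in>{1..<q} - {t}.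
        a q = 1 \<longleftrightarrow> s t < s p \<and> s p < s q \<or> s q < s p \<and> s p < s t) \<longleftrightarrow>
      ((\<forall>i\<in>{t<..n}. a i = -1) \<and>
       strict_mono_on {i\<in>{t<..n}. s i < s t} s \<and>
       strict_antimono_on {i\<in>{t<..n}. s t < s i} s) \<and>
      (\<forall>m\<in>{1..<t}. s t < s m \<longrightarrow> (\<forall>i\<in>{t<..n}. s i < s m)) \<and>
      (\<forall>m\<in>{1..<t}. s m < s t \<longrightarrow> (\<forall>i\<in>{t<..n}. s m < s i))"
    (is "?between \<longleftrightarrow> (?N \<and> ?I \<and> ?D) \<and> ?G \<and> ?L")
proof
  have neg: ?N using a none by fastforce
  assume btw: ?between
  have "\<not> (s t < s p \<and> s p < s q \<or> s q < s p \<and> s p < s t)"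
    if "t < q" "q \<le> n" "1 \<le> p" "p < q" "p \<noteq> t" for p q
    using btw neg that by fastforce
  moreover have "s p \<noteq> s q" if "p < q" for p q using inj that by simp
  ultimately have N: "(s t < s p \<longrightarrow> s q < s p) \<and> (s p < s t \<longrightarrow> s p < s q)"
    if "t < q" "q \<le> n" "1 \<le> p" "p < q" "p \<noteq> t" for p q
    using that by (meson linorder_neqE_nat)
  then show "(?N \<and> ?I \<and> ?D) \<and> ?G \<and> ?L"
    using neg t by (auto simp: monotone_on_def)
next
  assume "(?N \<and> ?I \<and> ?D) \<and> ?G \<and> ?L"
  then have N: ?N and I: ?I and D: ?D and G: ?G and L: ?L by blast+
  have I': "s i < s j" if "t < i" "i < j" "j \<le> n" "s i < s t" "s j < s t" for i j
    using I that by (auto simp: monotone_on_def)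
  have D': "s j < s i" if "t < i" "i < j" "j \<le> n" "s t < s i" "s t < s j" for i j
    using D that by (auto simp: monotone_on_def)
  show ?between
  proof (intro ballI)
    fix q p assume "q \<in> {t<..n}" "p \<in> {1..<q} - {t}"
    then have q: "q \<in> {t<..n}" "q \<le> n" and p: "1 \<le> p" "p < q" "p \<noteq> t" by auto
    have "\<not> (s t < s p \<and> s p < s q \<or> s q < s p \<and> s p < s t)"
    proof (cases "p < t")
      case True
      then have "p \<in> {1..<t}" using p by simp
      then show ?thesis using G L q(1) by (meson less_asym)
    next
      case False
      then have "t < p" using p by simp
      then show ?thesis using I'[of p q] D'[of p q] p q(2) by (meson less_asym less_trans)
    qed
    moreover have "a q = -1" using N q by auto
    ultimately show "a q = 1 \<longleftrightarrow> s t < s p \<and> s p < s q \<or> s q < s p \<and> s p < s t" by simp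
  qed
qed

theorem theorem9p1:
  fixes n t :: nat
    and L :: "nat \<Rightarrow> (real^2) set"
    and \<sigma> :: "nat \<Rightarrow> nat"
    and a :: "nat \<Rightarrow> int"
  assumes "n \<ge> 3"
    and "standard_position n L"
    and "infinity_type n L"
    and "infinity_permutation n L \<sigma>"
    and "nomenclature n L \<sigma> a"
    and "1 \<le> t" and "t < n" and "a t = 1"
  shows
    "(\<forall>u. t < u \<and> u \<le> n \<and> a u = 1 \<and> \<not> (\<exists>w. u < w \<and> w \<le> n \<and> a w = 1) \<and> \<sigma> t < \<sigma> u \<longrightarrow>
       (line_at_infinity (L (\<sigma> t)) (L ` {1..n}) \<longleftrightarrow>
          ((\<forall>i\<in>pos a {t<..n}. \<sigma> t < \<sigma> i) \<and> strict_mono_on (pos a {t<..n}) \<sigma>) \<and>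
          (\<forall>i\<in>neg a {t<..n}. \<forall>j\<in>pos a {t<..n}. \<sigma> i < \<sigma> j) \<and>
          (\<forall>m\<in>{1..<t}. \<sigma> t < \<sigma> m \<and>
             (\<forall>i\<in>neg a {t<..n}. \<sigma> i < \<sigma> m) \<and> (\<forall>j\<in>pos a {t<..n}. \<sigma> m < \<sigma> j)) \<and>
          ((\<forall>i\<in>neg a {t<..<u}. \<sigma> t < \<sigma> i) \<and> strict_antimono_on (neg a {t<..<u}) \<sigma>) \<and>
          ((\<forall>i\<in>{u<..n}. a i = -1) \<and>
           strict_mono_on {i\<in>{u<..n}. \<sigma> i < \<sigma> t} \<sigma> \<and>
           strict_antimono_on {i\<in>{u<..n}. \<sigma> t < \<sigma> i} \<sigma> \<and>
           (\<forall>i\<in>{u<..n}. \<sigma> t < \<sigma> i \<longrightarrow> (\<forall>j\<in>neg a {t<..<u}. \<sigma> i < \<sigma> j))))) \<and>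
     (\<not> (\<exists>u. t < u \<and> u \<le> n \<and> a u = 1) \<longrightarrow>
       (line_at_infinity (L (\<sigma> t)) (L ` {1..n}) \<longleftrightarrow>
          ((\<forall>i\<in>{t<..n}. a i = -1) \<and>
           strict_mono_on {i\<in>{t<..n}. \<sigma> i < \<sigma> t} \<sigma> \<and>
           strict_antimono_on {i\<in>{t<..n}. \<sigma> t < \<sigma> i} \<sigma>) \<and>
          (\<forall>m\<in>{1..<t}. \<sigma> t < \<sigma> m \<longrightarrow> (\<forall>i\<in>{t<..n}. \<sigma> i < \<sigma> m)) \<and>
          (\<forall>m\<in>{1..<t}. \<sigma> m < \<sigma> t \<longrightarrow> (\<forall>i\<in>{t<..n}. \<sigma> m < \<sigma> i)))) \<and>
     (\<forall>u. t < u \<and> u \<le> n \<and> a u = 1 \<and> \<not> (\<exists>w. u < w \<and> w \<le> n \<and> a w = 1) \<and> \<sigma> u < \<sigma> t \<longrightarrow>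
       (line_at_infinity (L (\<sigma> t)) (L ` {1..n}) \<longleftrightarrow>
          ((\<forall>i\<in>pos a {t<..n}. \<sigma> i < \<sigma> t) \<and> strict_antimono_on (pos a {t<..n}) \<sigma>) \<and>
          (\<forall>i\<in>neg a {t<..n}. \<forall>j\<in>pos a {t<..n}. \<sigma> j < \<sigma> i) \<and>
          (\<forall>m\<in>{1..<t}. \<sigma> m < \<sigma> t \<and>
             (\<forall>j\<in>pos a {t<..n}. \<sigma> j < \<sigma> m) \<and> (\<forall>i\<in>neg a {t<..n}. \<sigma> m < \<sigma> i)) \<and>
          ((\<forall>i\<in>neg a {t<..<u}. \<sigma> i < \<sigma> t) \<and> strict_mono_on (neg a {t<..<u}) \<sigma>) \<and>
          ((\<forall>i\<in>{u<..n}. a i = -1) \<and>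
           strict_antimono_on {i\<in>{u<..n}. \<sigma> t < \<sigma> i} \<sigma> \<and>
           strict_mono_on {i\<in>{u<..n}. \<sigma> i < \<sigma> t} \<sigma> \<and>
           (\<forall>i\<in>{u<..n}. \<sigma> i < \<sigma> t \<longrightarrow> (\<forall>j\<in>neg a {t<..<u}. \<sigma> j < \<sigma> i)))))"
proof -
  obtain M X where "slope_arrangement n L M X"
    using standard_position_imp_slope_arrangement assms(2) by blast
  then interpret slope_arrangement n L M X .
  have sup: "a i = superscript L \<sigma> i" if "i \<in> {1..n}" for i
    using assms(5) that unfolding nomenclature_def by blast
  have inj: "\<sigma> i = \<sigma> j \<longleftrightarrow> i = j" for i j by (rule sigma_eq_iff[OF assms(1,4)])
  have a: "a i = 1 \<or> a i = -1" if "i \<in> {t<..n}" for i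
    using sup[of i] that by (simp add: superscript_def)
  have t: "t \<in> {1..n}" using assms(6,7) by simp
  have inf: "line_at_infinity (L (\<sigma> t)) (L ` {1..n}) \<longleftrightarrow>
      (\<forall>q\<in>{t<..n}. \<forall>p\<in>{1..<q} - {t}.
        a q = 1 \<longleftrightarrow> \<sigma> t < \<sigma> p \<and> \<sigma> p < \<sigma> q \<or> \<sigma> q < \<sigma> p \<and> \<sigma> p < \<sigma> t)"
    using line_at_infinity_iff_between[OF assms(1,4) t] sup assms(8) t by auto
  note greater = between_iff_last_pos_greater[of t n a "\<lambda>i. int (\<sigma> i)"]
  \<comment> \<open>Negation reverses all comparisons and preserves betweenness, so the case
    \<open>\<sigma> u < \<sigma> t\<close> becomes the previous one.\<close>
  note smaller = between_iff_last_pos_greater[of t n a "\<lambda>i. - int (\<sigma> i)"]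
  note none = between_iff_no_pos[of t n a \<sigma>]
  show ?thesis
    unfolding inf
  proof (intro conjI allI impI, goal_cases)
    case (1 u)
    then show ?case
      using greater[of u] a inj assms(6) by (simp add: monotone_on_def)
  next
    case 2
    then show ?case using none a inj assms(6) by blast
  next
    case (3 u)
    then show ?case
      \<comment> \<open>The commutativity rules undo the swaps caused by negation in the betweenness
        alternatives and reorder the conjuncts on symbols before \<open>t\<close>.\<close>
      using smaller[of u] a inj assms(6) by (simp add: monotone_on_def disj_commute conj_commute)
  qed
qed

end
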